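(* Let $K=\mathbb{C}$, let $n=p+q\ge 6$ with $p,q\in\mathbb{N}$, and let $Cl_n$ be the Clifford algebra over $K$. Then there do not exist $k\ge1$ and a sequence $(f_1,\dots,f_k)$ of grade-negation operators on $Cl_n$ such that, putting $S_0=Cl_n$ and $S_i=(S_{i-1})^{f_i}=\{\alpha\in S_{i-1}: f_i(\alpha)=\alpha\}$, each $f_i$ ($1\le i\le k$) is a partial involution for $S_{i-1}$, and such that $f_k^{( * )}(Cl_n)\subset K$ or $f_k^{(\natural)}(Cl_n)\subset K$.
   Context: Clifford algebra: $Cl_n$ (with $n=p+q$) is the unital associative $K$-algebra with $K$-basis $\{1\}\cup\{e_{i_1}e_{i_2}\cdots e_{i_s} : 1\le i_1<i_2<\cdots<i_s\le n\}$ and relations $e_ie_j+e_je_i=0$ for $i\ne j$, $e_i^2=-1$ for $1\le i\le p$, $e_i^2=1$ for $p+1\le i\le n$. $K$ is identified with $K\cdot1$. Grade-negation operator: for a map $\delta:\{0,1,\dots,n\}\to\{\pm1\}$, $f_\delta:Cl_n\to Cl_n$ is the $K$-linear map with $f_\delta(e_{i_1}\cdots e_{i_s})=\delta(s)\,e_{i_1}\cdots e_{i_s}$ for $1\le i_1<\cdots<i_s\le n$ (for $s=0$ the basis element is $1$). Partial involution: for a subset $S\subset Cl_n$, a map $f:Cl_n\to Cl_n$ is a partial involution for $S$ if $f(\alpha\beta)=f(\beta)f(\alpha)$ and $f(f(\alpha))=\alpha$ for all $\alpha,\beta\in S$, and $f(1)=1$. Notation: $f^*(\alpha)=\alpha f(\alpha)$,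 $f^\natural(\alpha)=f(\alpha)\alpha$; $f_k^{( * )}=f_k^*\circ\cdots\circ f_1^*$ and $f_k^{(\natural)}=f_k^\natural\circ\cdots\circ f_1^\natural$. *)

theory Defs
  imports Complex_Main
begin

text \<open>\<open>blade e {i\<^sub>1 < \<dots> < i\<^sub>s} = e i\<^sub>1 * \<dots> * e i\<^sub>s\<close>; in particular \<open>blade e {} = 1\<close>.\<close>

definition blade :: "(nat \<Rightarrow> 'a::monoid_mult) \<Rightarrow> nat set \<Rightarrow> 'a" where
  "blade e A = prod_list (map e (sorted_list_of_set A))"

text \<open>
  The ring \<open>'a\<close>, with scalar multiplication \<open>scale\<close>, is the Clifford algebra with generators
  \<open>e 1, \<dots>, e (p + q)\<close>. The values of \<open>e\<close> at other indices are irrelevant. Injectivity is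
  needed because a basis is a family, whereas \<open>independent\<close> speaks about sets.
\<close>

locale clifford_algebra = vector_space scale
  for scale :: "'k::field \<Rightarrow> 'a::ring_1 \<Rightarrow> 'a" +
  fixes p q :: nat and e :: "nat \<Rightarrow> 'a"
  assumes scale_mult_left: "scale c x * y = scale c (x * y)"
    and scale_mult_right: "x * scale c y = scale c (x * y)"
    and anticommute:
      "\<lbrakk>i \<in> {1..p + q}; j \<in> {1..p + q}; i \<noteq> j\<rbrakk> \<Longrightarrow> e i * e j + e j * e i = 0"
    and square_neg: "i \<in> {1..p} \<Longrightarrow> e i * e i = - 1"
    and square_pos: "i \<in> {p + 1..p + q} \<Longrightarrow> e i * e i = 1"
    and blades_inj: "inj_on (blade e) (Pow {1..p + q})"
    and blades_independent: "independent (blade e ` Pow {1..p + q})"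
    and blades_span: "span (blade e ` Pow {1..p + q}) = UNIV"

definition scalars :: "('k::field \<Rightarrow> 'a::ring_1 \<Rightarrow> 'a) \<Rightarrow> 'a set" where
  "scalars scale = range (\<lambda>c. scale c 1)"

definition grade_negation ::
    "('k::field \<Rightarrow> 'a::ring_1 \<Rightarrow> 'a) \<Rightarrow> nat \<Rightarrow> (nat \<Rightarrow> 'a) \<Rightarrow> ('a \<Rightarrow> 'a) \<Rightarrow> bool" where
  "grade_negation scale n e f \<longleftrightarrow>
     Vector_Spaces.linear scale scale f \<and>
     (\<exists>\<delta> :: nat \<Rightarrow> 'k. (\<forall>s \<le> n. \<delta> s \<in> {1, - 1}) \<and>
        (\<forall>A \<subseteq> {1..n}. f (blade e A) = scale (\<delta> (card A)) (blade e A)))"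

definition partial_involution :: "'a::ring_1 set \<Rightarrow> ('a \<Rightarrow> 'a) \<Rightarrow> bool" where
  "partial_involution S f \<longleftrightarrow>
     (\<forall>\<alpha>\<in>S. \<forall>\<beta>\<in>S. f (\<alpha> * \<beta>) = f \<beta> * f \<alpha>) \<and> (\<forall>\<alpha>\<in>S. f (f \<alpha>) = \<alpha>) \<and> f 1 = 1"

text \<open>
  Below, a sequence \<open>(f\<^sub>1, \<dots>, f\<^sub>k)\<close> is a function \<open>f\<close> on \<open>nat\<close> of which only the
  values \<open>f 1, \<dots>, f k\<close> are used.
\<close>

primrec fixed_chain :: "(nat \<Rightarrow> 'a \<Rightarrow> 'a) \<Rightarrow> nat \<Rightarrow> 'a set" where
  "fixed_chain f 0 = UNIV"
| "fixed_chain f (Suc i) = {\<alpha> \<in> fixed_chain f i. f (Suc i) \<alpha> = \<alpha>}"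

definition star_map :: "('a::ring_1 \<Rightarrow> 'a) \<Rightarrow> 'a \<Rightarrow> 'a" where
  "star_map f \<alpha> = \<alpha> * f \<alpha>"

definition natural_map :: "('a::ring_1 \<Rightarrow> 'a) \<Rightarrow> 'a \<Rightarrow> 'a" where
  "natural_map f \<alpha> = f \<alpha> * \<alpha>"

primrec iterated_star :: "(nat \<Rightarrow> 'a::ring_1 \<Rightarrow> 'a) \<Rightarrow> nat \<Rightarrow> 'a \<Rightarrow> 'a" where
  "iterated_star f 0 = id"
| "iterated_star f (Suc i) = star_map (f (Suc i)) \<circ> iterated_star f i"

primrec iterated_natural :: "(nat \<Rightarrow> 'a::ring_1 \<Rightarrow> 'a) \<Rightarrow> nat \<Rightarrow> 'a \<Rightarrow> 'a" where
  "iterated_natural f 0 = id"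
| "iterated_natural f (Suc i) = natural_map (f (Suc i)) \<circ> iterated_natural f i"

end

theory Submission imports Defs begin

text \<open>
  Since \<open>n \<ge> 6\<close>, two blades \<open>u\<close>, \<open>v\<close> of grade 4 may overlap in exactly two indices; they then commute
  and \<open>u * v\<close> is, up to sign, again a blade of grade 4. Reversing this product forces
  \<open>\<delta> 4 = (\<delta> 4)\<^sup>2\<close>, that is \<open>\<delta> 4 = 1\<close>, for every operator in the sequence, so \<open>1\<close> and \<open>u\<close> are
  fixed throughout. Over the complex numbers some multiple \<open>w\<close> of \<open>u\<close> has square \<open>1\<close>, and then
  \<open>1 + w\<close> is twice an idempotent. All iterates map it to a nonzero multiple of itself, which is not
  a scalar.
\<close>

context clifford_algebra
begin

text \<open>The signature enters the proof only here: afterwards every square is known up to sign,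
  and \<open>p\<close> and \<open>q\<close> matter only through their sum.\<close>

lemma generator_square:
  assumes "i \<in> {1..p + q}"
  shows "e i * e i \<in> {1, - 1}"
proof (cases "i \<le> p")
  case True
  then show ?thesis using square_neg[of i] assms by simp
next
  case False
  then show ?thesis using square_pos[of i] assms by simp
qed

lemma generator_swap:
  assumes "i \<in> {1..p + q}" "j \<in> {1..p + q}" "i \<noteq> j"
  shows "e j * e i = - (e i * e j)"
  using anticommute[OF assms] by (simp add: eq_neg_iff_add_eq_0 add.commute)

lemma bivector_square:
  assumes "i \<in> {1..p + q}" "j \<in> {1..p + q}" "i \<noteq> j"
  shows "(e i * e j) * (e i * e j) \<in> {1, - 1}"
proof -
  have "(e i * e j) * (e i * e j) = e i * (e j * e i) * e j"
    by (simp only: mult.assoc)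
  also have "\<dots> = - ((e i * e i) * (e j * e j))"
    by (simp add: generator_swap[OF assms] mult.assoc)
  finally show ?thesis
    using generator_square[OF assms(1)] generator_square[OF assms(2)] by auto
qed

text \<open>Moving \<open>e l\<close> past two other generators costs two signs, which
  cancel.\<close>

lemma bivector_commutes_generator:
  assumes "i \<in> {1..p + q}" "j \<in> {1..p + q}" "l \<in> {1..p + q}" "l \<noteq> i" "l \<noteq> j"
  shows "e l * (e i * e j) = (e i * e j) * e l"
proof -
  have "e l * (e i * e j) = (e l * e i) * e j"
    by (simp only: mult.assoc)
  also have "\<dots> = - (e i * (e l * e j))"
    using generator_swap[of i l] assms by (simp add: mult.assoc)
  also have "\<dots> = (e i * e j) * e l"
    using generator_swap[of j l] assms by (simp add: mult.assoc)
  finally show ?thesis .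
qed

lemma bivectors_commute:
  assumes "{i, j, l, m} \<subseteq> {1..p + q}" "{i, j} \<inter> {l, m} = {}"
  shows "(e l * e m) * (e i * e j) = (e i * e j) * (e l * e m)"
proof -
  have "(e l * e m) * (e i * e j) = e l * (e m * (e i * e j))"
    by (simp only: mult.assoc)
  also have "\<dots> = (e l * (e i * e j)) * e m"
    using bivector_commutes_generator[of i j m] assms by (simp add: mult.assoc)
  also have "\<dots> = (e i * e j) * (e l * e m)"
    using bivector_commutes_generator[of i j l] assms by (simp add: mult.assoc)
  finally show ?thesis .
qed

text \<open>The scalars are the span of the empty blade \<open>1\<close>. Injectivity of
  \<open>blade e\<close> makes it a different basis vector from \<open>blade e A\<close>, so
  independence applies.\<close>

lemma blade_not_scalar:
  assumes "A \<subseteq> {1..p + q}" "A \<noteq> {}"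
  shows "blade e A \<notin> scalars scale"
proof
  assume "blade e A \<in> scalars scale"
  then have "blade e A \<in> span {blade e {}}"
    by (auto simp: scalars_def blade_def span_singleton)
  moreover have "blade e {} \<noteq> blade e A"
    using blades_inj assms by (metis Pow_bottom PowI inj_onD)
  then have "span {blade e {}} \<subseteq> span (blade e ` Pow {1..p + q} - {blade e A})"
    by (intro span_mono) auto
  ultimately have "blade e A \<in> span (blade e ` Pow {1..p + q} - {blade e A})"
    by blast
  then show False
    using blades_independent assms(1) by (auto simp: dependent_def)
qed

end

text \<open>On the line spanned by \<open>x\<close> each \<open>f i\<close> is the identity, so both
  maps reduce to squaring there. This sends the coefficient \<open>a\<close> to
  \<open>a * a * c\<close>, which stays nonzero.\<close>

lemma iterated_eigenvector:
  assumes "clifford_algebra scale p q e"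
    and "\<And>i a. i \<in> {1..k} \<Longrightarrow> f i (scale a x) = scale a x"
    and "x * x = scale c x" "c \<noteq> 0"
  shows "\<exists>a. a \<noteq> 0 \<and> iterated_star f k x = scale a x"
    and "\<exists>a. a \<noteq> 0 \<and> iterated_natural f k x = scale a x"
proof -
  interpret clifford_algebra scale p q e by fact
  have fixed_square: "scale a x * scale a x = scale (a * a * c) x" for a
    by (simp add: scale_mult_left scale_mult_right assms(3))
  show "\<exists>a. a \<noteq> 0 \<and> iterated_star f k x = scale a x"
    using assms(2)
  proof (induction k)
    case 0
    show ?case by (auto intro!: exI[of _ 1])
  next
    case (Suc k)
    then obtain a where "a \<noteq> 0" "iterated_star f k x = scale a x" by fastforce
    then show ?case
      using Suc.prems[of "Suc k" a] fixed_square[of a] \<open>c \<noteq> 0\<close>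
      by (auto simp: star_map_def intro!: exI[of _ "a * a * c"])
  qed
  show "\<exists>a. a \<noteq> 0 \<and> iterated_natural f k x = scale a x"
    using assms(2)
  proof (induction k)
    case 0
    show ?case by (auto intro!: exI[of _ 1])
  next
    case (Suc k)
    then obtain a where "a \<noteq> 0" "iterated_natural f k x = scale a x" by fastforce
    then show ?case
      using Suc.prems[of "Suc k" a] fixed_square[of a] \<open>c \<noteq> 0\<close>
      by (auto simp: natural_map_def intro!: exI[of _ "a * a * c"])
  qed
qed

theorem theorem9p2:
  fixes scale :: "complex \<Rightarrow> 'a::ring_1 \<Rightarrow> 'a"
    and p q :: nat and e :: "nat \<Rightarrow> 'a"
  assumes "clifford_algebra scale p q e"
    and "p + q \<ge> 6"
  shows "\<not> (\<exists>k \<ge> 1. \<exists>f :: nat \<Rightarrow> 'a \<Rightarrow> 'a.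
           (\<forall>i\<in>{1..k}. grade_negation scale (p + q) e (f i)) \<and>
           (\<forall>i\<in>{1..k}. partial_involution (fixed_chain f (i - 1)) (f i)) \<and>
           (range (iterated_star f k) \<subseteq> scalars scale \<or>
            range (iterated_natural f k) \<subseteq> scalars scale))"
proof (intro notI, elim exE conjE)
  fix k f
  assume neg: "\<forall>i\<in>{1..k}. grade_negation scale (p + q) e (f i)"
    and inv: "\<forall>i\<in>{1..k}. partial_involution (fixed_chain f (i - 1)) (f i)"
    and scalar: "range (iterated_star f k) \<subseteq> scalars scale \<or>
            range (iterated_natural f k) \<subseteq> scalars scale"
  interpret clifford_algebra scale p q e by fact
  \<comment> \<open>Three bivectors on disjoint index pairs commute pairwise; this is where six
    generators are used. The common factor \<open>a\<close> of \<open>u\<close> and \<open>v\<close>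
    squares to a sign, leaving the third grade 4 blade \<open>b * c\<close>.\<close>
  define a b c where "a = e 1 * e 2" and "b = e 3 * e 4" and "c = e 5 * e 6"
  define u v where "u = blade e {1, 2, 3, 4}" and "v = blade e {1, 2, 5, 6}"
  have u: "u = a * b" and v: "v = a * c" and w: "blade e {3, 4, 5, 6} = b * c"
    by (simp_all add: u_def v_def a_def b_def c_def blade_def mult.assoc)
  have ba: "b * a = a * b" and ca: "c * a = a * c" and cb: "c * b = b * c"
    using bivectors_commute[of 1 2 3 4] bivectors_commute[of 1 2 5 6]
      bivectors_commute[of 3 4 5 6] \<open>p + q \<ge> 6\<close>
    by (auto simp: a_def b_def c_def)
  have aa: "a * a \<in> {1, - 1}" and bb: "b * b \<in> {1, - 1}"
    using bivector_square[of 1 2] bivector_square[of 3 4] \<open>p + q \<ge> 6\<close>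
    by (auto simp: a_def b_def)
  \<comment> \<open>Right-associated products hide \<open>b * a\<close> inside
    \<open>a * (b * (a * c))\<close>, so the commutation is supplied together with its surrounding
    factors.\<close>
  have uv: "u * v = (a * a) * (b * c)"
    using arg_cong[OF ba, of "\<lambda>y. a * (y * c)"] by (simp add: u v mult.assoc)
  have vu: "v * u = (a * a) * (b * c)"
    using arg_cong[OF ca, of "\<lambda>y. a * (y * b)"] by (simp add: u v mult.assoc cb)
  have uu: "u * u \<in> {1, - 1}"
  proof -
    have "u * u = (a * a) * (b * b)"
      using arg_cong[OF ba, of "\<lambda>y. a * (y * b)"] by (simp add: u mult.assoc)
    then show ?thesis using aa bb by auto
  qed
  \<comment> \<open>Zero is a scalar, while the blade \<open>b * c\<close> is not.\<close>
  have bc: "b * c \<noteq> 0"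
    using blade_not_scalar[of "{3, 4, 5, 6}"] \<open>p + q \<ge> 6\<close> unfolding w
    by (auto simp: scalars_def image_iff intro: exI[of _ 0])

  have fixes_uv: "f i u = u \<and> f i v = v"
    if i: "i \<in> {1..k}" and "u \<in> fixed_chain f (i - 1)" "v \<in> fixed_chain f (i - 1)" for i
  proof -
    obtain \<delta> where lin: "Vector_Spaces.linear scale scale (f i)"
      and d4: "\<delta> (4::nat) \<in> {1, - 1 :: complex}"
      and \<delta>: "\<And>A. A \<subseteq> {1..p + q} \<Longrightarrow> f i (blade e A) = scale (\<delta> (card A)) (blade e A)"
      proof -
        from neg i obtain \<delta> where "Vector_Spaces.linear scale scale (f i)"
          and "\<forall>s \<le> p + q. \<delta> s \<in> {1, - 1 :: complex}"
          and "\<forall>A \<subseteq> {1..p + q}. f i (blade e A) = scale (\<delta> (card A)) (blade e A)"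
          unfolding grade_negation_def by blast
        moreover have "4 \<le> p + q" using \<open>p + q \<ge> 6\<close> by simp
        ultimately show ?thesis using that[of \<delta>] by blast
      qed
    interpret f: Vector_Spaces.linear scale scale "f i" by (rule lin)
    have grade4: "f i (blade e A) = scale (\<delta> 4) (blade e A)"
      if "A \<subseteq> {1..p + q}" "card A = 4" for A
      using \<delta>[OF that(1)] that(2) by simp
    have fu: "f i u = scale (\<delta> 4) u"
      unfolding u_def by (rule grade4) (use \<open>p + q \<ge> 6\<close> in auto)
    have fv: "f i v = scale (\<delta> 4) v"
      unfolding v_def by (rule grade4) (use \<open>p + q \<ge> 6\<close> in auto)
    have fw: "f i (b * c) = scale (\<delta> 4) (b * c)"
      unfolding w[symmetric] by (rule grade4) (use \<open>p + q \<ge> 6\<close> in auto)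
    have "f i (u * v) = f i v * f i u"
      using inv i that unfolding partial_involution_def by blast
    also have "\<dots> = scale (\<delta> 4 * \<delta> 4) (v * u)"
      by (simp add: fu fv scale_mult_left scale_mult_right)
    \<comment> \<open>The factor \<open>\<delta> 4 * \<delta> 4\<close> is 1 for either sign, and
      the sign \<open>a * a\<close> passes through \<open>f i\<close> by linearity and
      cancels.\<close>
    finally have "f i (b * c) = b * c"
      using aa d4 unfolding uv vu by (auto simp: f.neg)
    then have "scale (\<delta> 4) (b * c) = scale 1 (b * c)"
      by (simp add: fw)
    then have "\<delta> 4 = 1"
      using bc by (simp only: scale_cancel_right) blast
    then show ?thesis by (simp add: fu fv)
  qed
  \<comment> \<open>Being fixed by the next operator is exactly what puts \<open>u\<close> and
    \<open>v\<close> into the next stage, so \<open>fixes_uv\<close> applies again there.\<close>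
  have chain: "u \<in> fixed_chain f i \<and> v \<in> fixed_chain f i" if "i \<le> k" for i
    using that
  proof (induction i)
    case (Suc i)
    then show ?case using fixes_uv[of "Suc i"] by auto
  qed simp
  have fu: "f i u = u" if "i \<in> {1..k}" for i
    using that chain[of "i - 1"] fixes_uv[of i] by auto

  \<comment> \<open>If \<open>u * u = - 1\<close>, the factor \<open>\<i>\<close> corrects the sign;
    this is where the field has to contain a square root of -1.\<close>
  obtain z where "z \<noteq> 0" and zu: "scale z u * scale z u = 1"
  proof (cases "u * u = 1")
    case True
    then show ?thesis using that[of 1] by simp
  next
    case False
    then have "scale \<i> u * scale \<i> u = 1"
      using uu by (simp add: scale_mult_left scale_mult_right)
    then show ?thesis using that[of \<i>] by simp
  qed
  define x where "x = 1 + scale z u"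
  have two: "scale 2 y = y + y" for y
    using scale_left_distrib[of 1 1 y] by simp
  have "x * x = scale 2 x"
    by (simp add: x_def distrib_left distrib_right zu two add_ac)
  moreover have "f i (scale r x) = scale r x" if "i \<in> {1..k}" for i r
  proof -
    interpret f: Vector_Spaces.linear scale scale "f i"
      using neg that by (simp add: grade_negation_def)
    have "f i 1 = 1" using inv that by (simp add: partial_involution_def)
    then show ?thesis
      by (simp only: x_def f.scale f.add fu[OF that])
  qed
  \<comment> \<open>Both ranges contain a nonzero multiple of \<open>x\<close>, so whichever range
    consists of scalars provides \<open>r\<close>. The constant \<open>c\<close> of the lemma is 2
    here.\<close>
  ultimately obtain r where "r \<noteq> 0" and "scale r x \<in> scalars scale"
    using iterated_eigenvector[OF assms(1), of k f x 2] scalar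
    by (metis rangeI subsetD zero_neq_numeral)
  then obtain t where "scale r x = scale t 1"
    by (auto simp: scalars_def)
  \<comment> \<open>Subtracting the scalar part of \<open>scale r x\<close> isolates
    \<open>u\<close>; dividing by \<open>r * z\<close> would make this blade a scalar.\<close>
  then have "scale (r * z) u = scale (t - r) 1"
    by (simp add: x_def algebra_simps)
  then have "scale (inverse (r * z)) (scale (r * z) u) = scale (inverse (r * z) * (t - r)) 1"
    by simp
  then have "u = scale (inverse (r * z) * (t - r)) 1"
    using \<open>r \<noteq> 0\<close> \<open>z \<noteq> 0\<close> left_inverse[of "r * z"]
    unfolding scale_scale by (simp del: inverse_mult_distrib)
  then show False
    using blade_not_scalar[of "{1, 2, 3, 4}"] \<open>p + q \<ge> 6\<close> by (auto simp: u_def scalars_def)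
qed

end
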